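(* Let $K$ be a closed convex subset of $\mathbb{R}^n$ and let $\mu\in\mathbb{R}^n$. Let $\sigma>0$, $\xi\sim\mathcal{N}(0,\sigma^2I_{n\times n})$ and $y=\mu+\xi$. Assume that for some $u\in K$ there exists $t_*(u)>0$ such that $$\mathbb{E}\sup_{v\in K:\ |v-u|_2\le t_*(u)}\xi^T(v-u)\le\frac{t_*(u)^2}{2}.$$ Then for any $x>0$, with probability greater than $1-e^{-x}$, $$\|\hat\mu^{LS}(K)-\mu\|^2-\|u-\mu\|^2\le\frac{(t_*(u)+\sigma\sqrt{2x})^2}{n}\le\frac{2t_*^2(u)+4\sigma^2x}{n}.$$
   Context: Scaled norm: $\|v\|^2=\frac1n\sum_{i=1}^n v_i^2$ for $v\in\mathbb{R}^n$; $|\cdot|_2$ is the Euclidean norm. The least squares estimator over a nonempty closed set $K$ is $\hat\mu^{LS}(K)\in\operatorname{argmin}_{v\in K}\|y-v\|^2$. *)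

theory Defs
  imports "HOL-Probability.Probability"
begin

definition scaled_norm :: "real ^ 'n \<Rightarrow> real"
  where "scaled_norm v = sqrt ((1 / real CARD('n)) * (\<Sum>i\<in>UNIV. (v $ i)\<^sup>2))"

(* Density of N(0, sigma^2 I) with respect to Lebesgue measure: because the covariance
   is diagonal, it is the product of the univariate N(0, sigma^2) densities. *)
definition isotropic_normal_density :: "real \<Rightarrow> real ^ 'n \<Rightarrow> real"
  where "isotropic_normal_density \<sigma> z = (\<Prod>i\<in>UNIV. normal_density 0 \<sigma> (z $ i))"

(* Membership m \<in> argmin over v \<in> K of the squared scaled distance to y. A relation rather
   than a function, so that no choice among minimisers is built in. *)
definition least_squares_estimator :: "(real ^ 'n) set \<Rightarrow> real ^ 'n \<Rightarrow> real ^ 'n \<Rightarrow> bool"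
  where "least_squares_estimator K y m \<longleftrightarrow>
    is_arg_min (\<lambda>v. (scaled_norm (y - v))\<^sup>2) (\<lambda>v. v \<in> K) m"

end

theory Submission
  imports Defs
begin

text \<open>
  The excess risk of the projection is at most $2\,\xi^T d - |d|^2$ with $d = \hat\mu - u$; by convexity
  of $K$ this is controlled by the local supremum $Z = \sup \xi^T(v-u)$ over $|v-u| \le t$, with some room
  to spare, which yields the strict inequality. It remains to show that $Z$ has the sub-Gaussian upper tail
  $P(Z \ge E Z + r) \le \exp(-r^2/(2\sigma^2t^2))$ with the sharp constant. Put
  $W(s) = E \exp \sup_w (s\,\xi^T w - s^2\sigma^2|w|^2/2)$. Completing the square, $W(s)$ is the integral of
  $\exp(-d(z, s\sigma^2 T)^2/(2\sigma^2))$ up to normalisation, so the Prekopa-Leindler inequality gives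
  $W(s) \le W(s/2)^2$. Iterating, $W(s) \le W(s/2^k)^{2^k} \to \exp(s\,E Z)$, hence
  $E\,e^{sZ} \le \exp(s\,E Z + s^2\sigma^2t^2/2)$, and Markov's inequality concludes.
\<close>

section \<open>The Prekopa-Leindler inequality\<close>

lemma emeasure_lborel_eq_SUP_lessThan:
  fixes A :: "real set"
  assumes A [measurable]: "A \<in> sets borel" and ne: "A \<noteq> {}"
  shows "emeasure lborel A = (SUP a\<in>A. emeasure lborel (A \<inter> {..<a}))"
proof (rule antisym)
  have "(\<Union>k. A \<inter> {..real k}) = A"
    using real_arch_simple by auto
  then have "emeasure lborel A = (SUP k. emeasure lborel (A \<inter> {..real k}))"
    by (subst SUP_emeasure_incseq) (auto simp: incseq_def)
  also have "\<dots> \<le> (SUP a\<in>A. emeasure lborel (A \<inter> {..<a}))"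
  proof (rule SUP_least)
    fix k
    define B where "B = A \<inter> {..real k}"
    show "emeasure lborel (A \<inter> {..real k}) \<le> (SUP a\<in>A. emeasure lborel (A \<inter> {..<a}))"
    proof (cases "B = {}")
      case True then show ?thesis by (simp add: B_def)
    next
      case False
      have bdd: "bdd_above B" by (auto simp: B_def)
      show ?thesis
      proof (rule ennreal_le_epsilon)
        fix e :: real assume e: "e > 0"
        \<comment> \<open>The supremum of \<open>B\<close> need not be attained, and cut points must
          belong to \<open>A\<close>. Cutting at a point of \<open>B\<close> within \<open>e\<close>
          of \<open>Sup B\<close> loses only a subset of an interval of length less than
          \<open>e\<close>.\<close>
        obtain a where a: "a \<in> B" "Sup B - e < a"
          using less_cSupE[OF _ False, of "Sup B - e"] e by auto
        have "emeasure lborel B \<le> emeasure lborel ((A \<inter> {..<a}) \<union> {a..Sup B})"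
          by (rule emeasure_mono) (auto simp: B_def intro!: cSup_upper bdd[unfolded B_def])
        also have "\<dots> \<le> emeasure lborel (A \<inter> {..<a}) + emeasure lborel {a..Sup B}"
          by (intro emeasure_subadditive) auto
        also have "emeasure lborel {a..Sup B} \<le> ennreal e"
          using a cSup_upper[OF a(1) bdd] by (auto intro!: ennreal_leI)
        also have "emeasure lborel (A \<inter> {..<a}) \<le> (SUP a\<in>A. emeasure lborel (A \<inter> {..<a}))"
          using a by (intro SUP_upper) (auto simp: B_def)
        finally show "emeasure lborel (A \<inter> {..real k})
            \<le> (SUP a\<in>A. emeasure lborel (A \<inter> {..<a})) + ennreal e"
          by (auto simp: B_def add_left_mono add_right_mono)
      qed
    qed
  qed
  finally show "emeasure lborel A \<le> (SUP a\<in>A. emeasure lborel (A \<inter> {..<a}))" .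
qed (auto intro!: SUP_least emeasure_mono)

lemma emeasure_lborel_shift:
  fixes A :: "real set"
  assumes "A \<in> sets borel"
  shows "emeasure lborel {z. z - b \<in> A} = emeasure lborel A"
proof -
  have "emeasure lborel A = emeasure (distr lborel borel ((+) (-b))) A"
    by (simp add: lborel_distr_plus)
  also have "\<dots> = emeasure lborel {z. z - b \<in> A}"
    using assms by (subst emeasure_distr) (auto intro!: arg_cong[where f="emeasure lborel"])
  finally show ?thesis by simp
qed

lemma emeasure_lborel_uminus:
  fixes A :: "real set"
  assumes "A \<in> sets borel"
  shows "emeasure lborel {z. - z \<in> A} = emeasure lborel A"
proof -
  have "emeasure lborel A = emeasure (distr lborel borel uminus) A"
    by (simp add: lborel_distr_uminus)
  also have "\<dots> = emeasure lborel {z. - z \<in> A}"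
    using assms by (subst emeasure_distr) (auto intro!: arg_cong[where f="emeasure lborel"])
  finally show ?thesis by simp
qed

text \<open>Cutting \<open>A\<close> and \<open>B\<close> at points of their own allows disjoint
  translates of the two pieces to be placed inside the sumset; letting the cut points vary recovers
  the full measures. The Borel set \<open>C\<close> stands for any superset of the sumset, so
  measurability of the sumset itself never has to be discussed.\<close>

lemma Brunn_Minkowski_real:
  fixes A B C :: "real set"
  assumes A [measurable]: "A \<in> sets borel" and B [measurable]: "B \<in> sets borel"
    and C [measurable]: "C \<in> sets borel"
    and ne: "A \<noteq> {}" "B \<noteq> {}" and sub: "\<And>a b. a \<in> A \<Longrightarrow> b \<in> B \<Longrightarrow> a + b \<in> C"
  shows "emeasure lborel A + emeasure lborel B \<le> emeasure lborel C"
proof -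
  \<comment> \<open>Reflection turns pieces of \<open>B\<close> to the right of a point into pieces
    of \<open>B'\<close> to the left of one, so the same approximation from below serves both
    sets.\<close>
  define B' where "B' = {z. - z \<in> B}"
  have B' [measurable]: "B' \<in> sets borel" unfolding B'_def by measurable
  have B'ne: "B' \<noteq> {}" using ne(2) unfolding B'_def by (metis empty_Collect_eq ex_in_conv minus_minus)
  \<comment> \<open>The translates of the part of \<open>A\<close> left of \<open>a\<close> and of the part of \<open>B\<close> right of \<open>- b\<close>
    both lie in \<open>C\<close>, on different sides of \<open>a - b\<close>.\<close>
  have split: "emeasure lborel (A \<inter> {..<a}) + emeasure lborel (B' \<inter> {..<b}) \<le> emeasure lborel C"
    if ab: "a \<in> A" "b \<in> B'" for a b
  proof -
    let ?S = "{z. z - (- b) \<in> A \<inter> {..<a}}" and ?T = "{z. - (z - a) \<in> B' \<inter> {..<b}}"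
    have Y: "{z. - z \<in> B' \<inter> {..<b}} \<in> sets borel" by measurable
    have "emeasure lborel (B' \<inter> {..<b}) = emeasure lborel ?T"
      using emeasure_lborel_shift[OF Y, of a] by (simp add: emeasure_lborel_uminus del: Int_iff)
    moreover have "emeasure lborel (A \<inter> {..<a}) = emeasure lborel ?S"
      by (subst emeasure_lborel_shift) auto
    ultimately have "emeasure lborel (A \<inter> {..<a}) + emeasure lborel (B' \<inter> {..<b})
      = emeasure lborel ?S + emeasure lborel ?T" by simp
    also have "\<dots> = emeasure lborel (?S \<union> ?T)"
    proof (rule plus_emeasure)
      show "?S \<in> sets lborel" "?T \<in> sets lborel" by measurable
    qed auto
    also have "\<dots> \<le> emeasure lborel C"
    proof (rule emeasure_mono)
      show "?S \<union> ?T \<subseteq> C"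
      proof
        fix z assume "z \<in> ?S \<union> ?T"
        then show "z \<in> C" using sub[of "z + b" "- b"] sub[of a "z - a"] ab
          by (auto simp: B'_def)
      qed
    qed simp
    finally show ?thesis .
  qed
  have "emeasure lborel A + emeasure lborel B'
    = (SUP a\<in>A. SUP b\<in>B'. emeasure lborel (A \<inter> {..<a}) + emeasure lborel (B' \<inter> {..<b}))"
    unfolding ennreal_SUP_add_right[OF B'ne, symmetric] ennreal_SUP_add_left[OF ne(1)]
    by (simp only: emeasure_lborel_eq_SUP_lessThan[OF A ne(1)] emeasure_lborel_eq_SUP_lessThan[OF B' B'ne])
  also have "\<dots> \<le> emeasure lborel C"
    using split by (intro SUP_least)
  finally show ?thesis by (simp add: B'_def emeasure_lborel_uminus)
qed

lemma emeasure_midpoints_ge: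
  fixes A B C :: "real set"
  assumes "A \<in> sets borel" "B \<in> sets borel" and C [measurable]: "C \<in> sets borel"
    and "A \<noteq> {}" "B \<noteq> {}" and "\<And>a b. a \<in> A \<Longrightarrow> b \<in> B \<Longrightarrow> (a + b) / 2 \<in> C"
  shows "emeasure lborel A + emeasure lborel B \<le> 2 * emeasure lborel C"
proof -
  have [measurable]: "{z. z / 2 \<in> C} \<in> sets borel" by measurable
  have "emeasure lborel {z. z / 2 \<in> C} = (\<integral>\<^sup>+z. indicator {z. z / 2 \<in> C} z \<partial>lborel)"
    by (subst nn_integral_indicator) auto
  also have "\<dots> = 2 * (\<integral>\<^sup>+z. indicator {z. z / 2 \<in> C} (0 + 2 * z) \<partial>lborel)"
    by (subst nn_integral_real_affine[where c=2 and t=0]) auto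
  also have "\<dots> = 2 * emeasure lborel C"
    using nn_integral_indicator[of C lborel] by (simp add: indicator_def)
  finally show ?thesis
    using Brunn_Minkowski_real[of A B "{z. z / 2 \<in> C}"] assms by auto
qed

section \<open>Layer-cake formula and the functional inequality on the real line\<close>

lemma emeasure_lborel_strict_hypograph:
  "emeasure lborel {t. 0 \<le> t \<and> ennreal t < c} = c"
proof (cases c)
  case (real r)
  then have "{t. 0 \<le> t \<and> ennreal t < c} = {0..<r}"
    by (auto simp: ennreal_less_iff)
  then show ?thesis using real by simp
next
  case top
  then have "{t. 0 \<le> t \<and> ennreal t < c} = {0..}" by auto
  moreover have "emeasure lborel {0::real..} = \<infinity>" 
  proof -
    have "ennreal (real n) \<le> emeasure lborel {0::real..}" for n
      using emeasure_mono[of "{0..real n}" "{0..}" lborel] by simp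
    then have "(SUP n. of_nat n) \<le> emeasure lborel {0::real..}"
      by (intro SUP_least) (simp add: ennreal_of_nat_eq_real_of_nat)
    then show ?thesis by (simp add: ennreal_SUP_of_nat_eq_top top_unique)
  qed
  ultimately show ?thesis using top by simp
qed

text \<open>Both sides measure the region strictly under the graph of \<open>f\<close>, sliced
  vertically and horizontally; Fubini exchanges the two slicings.\<close>

lemma nn_integral_eq_integral_superlevel:
  fixes f :: "real \<Rightarrow> ennreal"
  assumes f [measurable]: "f \<in> borel_measurable borel"
  shows "(\<integral>\<^sup>+x. f x \<partial>lborel)
    = (\<integral>\<^sup>+t. indicator {0..} t * emeasure lborel {x. ennreal t < f x} \<partial>lborel)"
proof -
  have "(\<integral>\<^sup>+x. f x \<partial>lborel) = (\<integral>\<^sup>+x. emeasure lborel {t. 0 \<le> t \<and> ennreal t < f x} \<partial>lborel)"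
    by (simp only: emeasure_lborel_strict_hypograph)
  also have "\<dots> = (\<integral>\<^sup>+x. \<integral>\<^sup>+t. indicator {t. 0 \<le> t \<and> ennreal t < f x} t \<partial>lborel \<partial>lborel)"
    by (intro nn_integral_cong, subst nn_integral_indicator) auto
  also have "\<dots> = (\<integral>\<^sup>+t. \<integral>\<^sup>+x. indicator {t. 0 \<le> t \<and> ennreal t < f x} t \<partial>lborel \<partial>lborel)"
    by (rule lborel_pair.Fubini') (auto simp: indicator_def split_beta')
  also have "\<dots> = (\<integral>\<^sup>+t. \<integral>\<^sup>+x. indicator {0..} t * indicator {x. ennreal t < f x} x \<partial>lborel \<partial>lborel)"
    by (intro nn_integral_cong) (auto simp: indicator_def)
  also have "\<dots> = (\<integral>\<^sup>+t. indicator {0..} t * emeasure lborel {x. ennreal t < f x} \<partial>lborel)"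
    by (intro nn_integral_cong, subst nn_integral_cmult) auto
  finally show ?thesis .
qed

lemma mult_strict_mono_ennreal:
  fixes a b c d :: ennreal
  assumes "a < b" "c < d"
  shows "a * c < b * d"
proof -
  have "a < \<top>" using assms(1) by (metis less_le_trans top_greatest)
  have "b > 0" using assms(1) by (metis le_less_trans zero_le)
  have "a * c \<le> b * c" using assms by (intro mult_right_mono) auto
  show ?thesis
  proof (cases "b = \<top>")
    case True
    then show ?thesis using assms \<open>a < \<top>\<close>
      by (metis ennreal_mult_less_top ennreal_top_mult less_le_trans not_less_zero top_greatest)
  next
    case False
    with \<open>b > 0\<close> have "b * c < b * d"
      using assms by (intro ennreal_mult_strict_left_mono) (auto simp: less_top)
    with \<open>a * c \<le> b * c\<close> show ?thesis by simp
  qed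
qed

text \<open>With both suprema equal to 1, the superlevel sets of \<open>f\<close> and
  \<open>g\<close> are nonempty at every level below 1 and empty from 1 on. Below 1 their midpoints
  lie in the superlevel set of \<open>h\<close>, so the midpoint bound holds level by level and is
  then integrated over the level. The resulting bound on the sum is stronger than the one on the
  product.\<close>

lemma Prekopa_Leindler_real_normalized:
  fixes f g h :: "real \<Rightarrow> ennreal"
  assumes [measurable]: "f \<in> borel_measurable borel" "g \<in> borel_measurable borel" "h \<in> borel_measurable borel"
    and f1: "(SUP x. f x) = 1" and g1: "(SUP x. g x) = 1"
    and le: "\<And>x y. f x * g y \<le> (h ((x + y) / 2))\<^sup>2"
  shows "(\<integral>\<^sup>+x. f x \<partial>lborel) + (\<integral>\<^sup>+x. g x \<partial>lborel) \<le> 2 * (\<integral>\<^sup>+x. h x \<partial>lborel)"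
proof -
  have level: "emeasure lborel {x. ennreal t < f x} + emeasure lborel {x. ennreal t < g x}
      \<le> 2 * emeasure lborel {x. ennreal t < h x}" if t: "0 \<le> t" for t
  proof (cases "t < 1")
    case True
    then have t1: "ennreal t < 1" using t by (simp add: ennreal_less_one_iff)
    show ?thesis
    proof (rule emeasure_midpoints_ge)
      show "{x. ennreal t < f x} \<noteq> {}" "{x. ennreal t < g x} \<noteq> {}"
        using t1 f1 g1 by (metis (mono_tags, lifting) empty_Collect_eq less_SUP_iff)+
      fix a b assume "a \<in> {x. ennreal t < f x}" "b \<in> {x. ennreal t < g x}"
      then have "ennreal t * ennreal t < f a * g b"
        using t by (intro mult_strict_mono_ennreal) auto
      also have "\<dots> \<le> (h ((a + b) / 2))\<^sup>2" by (rule le)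
      finally have "ennreal t < h ((a + b) / 2)"
        by (metis mult_mono not_less power2_eq_square zero_le)
      then show "(a + b) / 2 \<in> {x. ennreal t < h x}" by simp
    qed auto
  next
    case False
    then have "1 \<le> ennreal t" by simp
    then have "\<not> ennreal t < f x" "\<not> ennreal t < g x" for x
      using f1 g1 by (metis SUP_upper UNIV_I not_less order_trans)+
    then show ?thesis by simp
  qed
  have "(\<integral>\<^sup>+x. f x \<partial>lborel) + (\<integral>\<^sup>+x. g x \<partial>lborel)
    = (\<integral>\<^sup>+t. indicator {0..} t * (emeasure lborel {x. ennreal t < f x} + emeasure lborel {x. ennreal t < g x}) \<partial>lborel)"
    unfolding nn_integral_eq_integral_superlevel[OF assms(1)] nn_integral_eq_integral_superlevel[OF assms(2)]
    by (simp add: distrib_left nn_integral_add)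
  also have "\<dots> \<le> (\<integral>\<^sup>+t. 2 * (indicator {0..} t * emeasure lborel {x. ennreal t < h x}) \<partial>lborel)"
    using level by (intro nn_integral_mono) (auto simp: indicator_def)
  also have "\<dots> = 2 * (\<integral>\<^sup>+x. h x \<partial>lborel)"
    unfolding nn_integral_eq_integral_superlevel[OF assms(3)]
    by (simp add: nn_integral_cmult)
  finally show ?thesis .
qed

lemma ennreal_arith_geo_mean:
  fixes a b c :: ennreal
  assumes "a + b \<le> 2 * c"
  shows "a * b \<le> c\<^sup>2"
proof (cases a; cases b; cases c)
  fix r s q :: real
  assume *: "0 \<le> r" "a = ennreal r" "0 \<le> s" "b = ennreal s" "0 \<le> q" "c = ennreal q"
  have "ennreal (r + s) \<le> ennreal (2 * q)"
    using assms * by (simp add: ennreal_mult ennreal_plus)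
  then have "r + s \<le> 2 * q" using * by (subst (asm) ennreal_le_iff) auto
  then have "(r + s)\<^sup>2 \<le> (2 * q)\<^sup>2" using * by (intro power_mono) auto
  then have "r * s \<le> q\<^sup>2" using zero_le_power2[of "r - s"]
    by (simp add: power2_eq_square algebra_simps)
  then show ?thesis using * by (simp add: ennreal_power flip: ennreal_mult)
qed (use assms in \<open>auto simp: ennreal_mult_eq_top_iff top_unique power2_eq_square ennreal_top_mult ennreal_mult_top\<close>)

lemma Prekopa_Leindler_real_bounded:
  fixes f g h :: "real \<Rightarrow> ennreal"
  assumes [measurable]: "f \<in> borel_measurable borel" "g \<in> borel_measurable borel" "h \<in> borel_measurable borel"
    and f1: "(SUP x. f x) < \<top>" and g1: "(SUP x. g x) < \<top>"
    and le: "\<And>x y. f x * g y \<le> (h ((x + y) / 2))\<^sup>2"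
  shows "(\<integral>\<^sup>+x. f x \<partial>lborel) * (\<integral>\<^sup>+x. g x \<partial>lborel) \<le> (\<integral>\<^sup>+x. h x \<partial>lborel)\<^sup>2"
proof (cases "(SUP x. f x) = 0 \<or> (SUP x. g x) = 0")
  case True
  then have "(\<forall>x. f x = 0) \<or> (\<forall>x. g x = 0)"
    by (metis SUP_upper UNIV_I le_zero_eq)
  then show ?thesis by auto
next
  case False
  obtain r where r: "(SUP x. f x) = ennreal r" "0 < r"
    using f1 False by (cases "SUP x. f x") (auto simp: less_le)
  obtain s where s: "(SUP x. g x) = ennreal s" "0 < s"
    using g1 False by (cases "SUP x. g x") (auto simp: less_le)
  \<comment> \<open>The hypothesis is homogeneous: scaling \<open>f\<close> by 1/r and
    \<open>g\<close> by 1/s forces \<open>h\<close> to be scaled by the geometric mean of the two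
    factors. After the arithmetic-geometric mean inequality the factor \<open>c\<close> squared
    cancels.\<close>
  define c where "c = sqrt (1 / r * (1 / s))"
  have c: "c > 0" "c\<^sup>2 = 1 / r * (1 / s)" using r s by (auto simp: c_def)
  have cc: "(ennreal c)\<^sup>2 = ennreal (1 / r) * ennreal (1 / s)"
    using c r s by (simp add: ennreal_power flip: ennreal_mult)
  have "(\<integral>\<^sup>+x. ennreal (1 / r) * f x \<partial>lborel) + (\<integral>\<^sup>+x. ennreal (1 / s) * g x \<partial>lborel)
      \<le> 2 * (\<integral>\<^sup>+x. ennreal c * h x \<partial>lborel)"
  proof (rule Prekopa_Leindler_real_normalized)
    show "(SUP x. ennreal (1 / r) * f x) = 1"
      using r by (simp flip: SUP_mult_left_ennreal ennreal_mult)
    show "(SUP x. ennreal (1 / s) * g x) = 1"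
      using s by (simp flip: SUP_mult_left_ennreal ennreal_mult)
    fix x y
    have "ennreal (1 / r) * f x * (ennreal (1 / s) * g y) = (ennreal c)\<^sup>2 * (f x * g y)"
      by (simp add: cc ac_simps)
    also have "\<dots> \<le> (ennreal c * h ((x + y) / 2))\<^sup>2"
      using le by (simp add: power_mult_distrib mult_left_mono)
    finally show "ennreal (1 / r) * f x * (ennreal (1 / s) * g y) \<le> (ennreal c * h ((x + y) / 2))\<^sup>2" .
  qed auto
  then have "(ennreal (1 / r) * (\<integral>\<^sup>+x. f x \<partial>lborel)) * (ennreal (1 / s) * (\<integral>\<^sup>+x. g x \<partial>lborel))
      \<le> (ennreal c * (\<integral>\<^sup>+x. h x \<partial>lborel))\<^sup>2"
    by (intro ennreal_arith_geo_mean) (simp add: nn_integral_cmult)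
  then have "(ennreal c)\<^sup>2 * ((\<integral>\<^sup>+x. f x \<partial>lborel) * (\<integral>\<^sup>+x. g x \<partial>lborel))
      \<le> (ennreal c)\<^sup>2 * (\<integral>\<^sup>+x. h x \<partial>lborel)\<^sup>2"
    unfolding power_mult_distrib by (simp add: cc ac_simps)
  then show ?thesis
    using c(1) by (subst (asm) ennreal_mult_le_mult_iff) (auto simp: ennreal_power)
qed

lemma nn_integral_eq_SUP_truncation:
  fixes f :: "'a \<Rightarrow> ennreal"
  assumes [measurable]: "f \<in> borel_measurable M"
  shows "(\<integral>\<^sup>+x. f x \<partial>M) = (SUP k. \<integral>\<^sup>+x. min (f x) (of_nat k) \<partial>M)"
proof -
  have "(SUP k. min (f x) (of_nat k)) = f x" for x
    using inf_SUP[of "f x" "of_nat :: nat \<Rightarrow> ennreal" UNIV]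
    by (simp add: inf_min ennreal_SUP_of_nat_eq_top)
  then have "(\<integral>\<^sup>+x. f x \<partial>M) = (\<integral>\<^sup>+x. (SUP k. min (f x) (of_nat k)) \<partial>M)"
    by simp
  also have "\<dots> = (SUP k. \<integral>\<^sup>+x. min (f x) (of_nat k) \<partial>M)"
    by (intro nn_integral_monotone_convergence_SUP)
       (auto simp: incseq_def le_fun_def min_le_iff_disj intro: min.coboundedI2)
  finally show ?thesis .
qed

lemma Prekopa_Leindler_real:
  fixes f g h :: "real \<Rightarrow> ennreal"
  assumes [measurable]: "f \<in> borel_measurable borel" "g \<in> borel_measurable borel" "h \<in> borel_measurable borel"
    and le: "\<And>x y. f x * g y \<le> (h ((x + y) / 2))\<^sup>2"
  shows "(\<integral>\<^sup>+x. f x \<partial>lborel) * (\<integral>\<^sup>+x. g x \<partial>lborel) \<le> (\<integral>\<^sup>+x. h x \<partial>lborel)\<^sup>2"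
proof -
  \<comment> \<open>Truncating \<open>f\<close> and \<open>g\<close> while keeping \<open>h\<close>
    preserves the hypothesis. Independent truncation levels \<open>j\<close> and \<open>k\<close>
    allow the two suprema to be taken out of the product separately.\<close>
  have "(\<integral>\<^sup>+x. min (f x) (of_nat j) \<partial>lborel) * (\<integral>\<^sup>+x. min (g x) (of_nat k) \<partial>lborel)
      \<le> (\<integral>\<^sup>+x. h x \<partial>lborel)\<^sup>2" for j k
  proof (rule Prekopa_Leindler_real_bounded)
    show "(SUP x. min (f x) (of_nat j)) < \<top>" "(SUP x. min (g x) (of_nat k)) < \<top>"
      by (auto intro!: le_less_trans[OF SUP_least[OF min.cobounded2]] of_nat_less_top)
    fix x y
    have "min (f x) (of_nat j) * min (g y) (of_nat k) \<le> f x * g y"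
      by (intro mult_mono) auto
    also note le
    finally show "min (f x) (of_nat j) * min (g y) (of_nat k) \<le> (h ((x + y) / 2))\<^sup>2" .
  qed auto
  then show ?thesis
    by (simp add: nn_integral_eq_SUP_truncation[of f] nn_integral_eq_SUP_truncation[of g]
        SUP_mult_left_ennreal SUP_mult_right_ennreal SUP_least)
qed

section \<open>Higher dimensions by induction over the coordinates\<close>

definition midpoint_on :: "'i set \<Rightarrow> ('i \<Rightarrow> real) \<Rightarrow> ('i \<Rightarrow> real) \<Rightarrow> 'i \<Rightarrow> real"
  where "midpoint_on I x y = (\<lambda>i\<in>I. (x i + y i) / 2)"

text \<open>Integrating out one coordinate preserves the hypothesis: for fixed remaining coordinates
  the one-dimensional inequality is precisely the hypothesis for the marginals. Points are taken
  extensional because these form the space of the product measure, and \<open>midpoint_on\<close>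
  restricts to \<open>I\<close> to stay among them.\<close>

lemma Prekopa_Leindler_PiM:
  fixes f g h :: "('i \<Rightarrow> real) \<Rightarrow> ennreal"
  assumes "finite I"
    and "f \<in> borel_measurable (Pi\<^sub>M I (\<lambda>_. lborel))" "g \<in> borel_measurable (Pi\<^sub>M I (\<lambda>_. lborel))"
      "h \<in> borel_measurable (Pi\<^sub>M I (\<lambda>_. lborel))"
    and "\<And>x y. x \<in> extensional I \<Longrightarrow> y \<in> extensional I \<Longrightarrow> f x * g y \<le> (h (midpoint_on I x y))\<^sup>2"
  shows "integral\<^sup>N (Pi\<^sub>M I (\<lambda>_. lborel)) f * integral\<^sup>N (Pi\<^sub>M I (\<lambda>_. lborel)) g
    \<le> (integral\<^sup>N (Pi\<^sub>M I (\<lambda>_. lborel)) h)\<^sup>2"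
  using assms
proof (induction I arbitrary: f g h rule: finite_induct)
  case empty
  interpret product_sigma_finite "\<lambda>_::'i. lborel :: real measure" ..
  \<comment> \<open>The empty product has a single point, the function that is
    \<open>undefined\<close> everywhere.\<close>
  show ?case using empty(4)[of "\<lambda>_. undefined" "\<lambda>_. undefined"]
    by (simp add: nn_integral_empty midpoint_on_def restrict_def)
next
  case (insert i I)
  interpret product_sigma_finite "\<lambda>_::'i. lborel :: real measure" ..
  have marg: "(\<lambda>a. \<integral>\<^sup>+ y. F (a(i := y)) \<partial>lborel) \<in> borel_measurable (Pi\<^sub>M I (\<lambda>_. lborel))"
    if "F \<in> borel_measurable (Pi\<^sub>M (insert i I) (\<lambda>_. lborel))" for F :: "('i \<Rightarrow> real) \<Rightarrow> ennreal"
  proof (rule lborel.borel_measurable_nn_integral)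
    show "(\<lambda>(a, y). F (a(i := y))) \<in> borel_measurable (Pi\<^sub>M I (\<lambda>_. lborel) \<Otimes>\<^sub>M lborel)"
      using measurable_compose[OF measurable_add_dim that] by (simp only: split_beta')
  qed
  show ?case
    unfolding product_nn_integral_insert[OF insert.hyps insert.prems(1)]
      product_nn_integral_insert[OF insert.hyps insert.prems(2)]
      product_nn_integral_insert[OF insert.hyps insert.prems(3)]
  proof (rule insert.IH)
    fix x y :: "'i \<Rightarrow> real" assume xy: "x \<in> extensional I" "y \<in> extensional I"
    have sp: "x \<in> space (Pi\<^sub>M I (\<lambda>_. lborel))" if "x \<in> extensional I" for x :: "'i \<Rightarrow> real"
      using that by (simp add: space_PiM PiE_def)
    have meas: "(\<lambda>r. F (z(i := r))) \<in> borel_measurable borel"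
      if "F \<in> borel_measurable (Pi\<^sub>M (insert i I) (\<lambda>_. lborel))" "z \<in> extensional I"
      for F :: "('i \<Rightarrow> real) \<Rightarrow> ennreal" and z
    proof -
      note [measurable] = that(1)
      have "(\<lambda>r. F (z(i := r))) \<in> borel_measurable lborel"
        using sp[OF that(2)] by measurable
      then show ?thesis by simp
    qed
    show "(\<integral>\<^sup>+ r. f (x(i := r)) \<partial>lborel) * (\<integral>\<^sup>+ r. g (y(i := r)) \<partial>lborel)
       \<le> (\<integral>\<^sup>+ r. h ((midpoint_on I x y)(i := r)) \<partial>lborel)\<^sup>2"
    proof (rule Prekopa_Leindler_real)
      fix r s :: real
      have "(midpoint_on I x y)(i := (r + s) / 2) = midpoint_on (insert i I) (x(i := r)) (y(i := s))"
        using insert.hyps by (auto simp: midpoint_on_def fun_eq_iff)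
      moreover have "x(i := r) \<in> extensional (insert i I)" "y(i := s) \<in> extensional (insert i I)"
        using xy by (auto simp: extensional_def)
      ultimately show "f (x(i := r)) * g (y(i := s)) \<le> (h ((midpoint_on I x y)(i := (r + s) / 2)))\<^sup>2"
        using insert.prems(4) by simp
    next
      have "midpoint_on I x y \<in> extensional I" by (simp add: midpoint_on_def)
      then show "(\<lambda>r. h ((midpoint_on I x y)(i := r))) \<in> borel_measurable borel"
        by (rule meas[OF insert.prems(3)])
    qed (fact meas[OF insert.prems(1) xy(1)] meas[OF insert.prems(2) xy(2)])+
  qed (rule marg, fact)+
qed

theorem Prekopa_Leindler:
  fixes f g h :: "'a::euclidean_space \<Rightarrow> ennreal"
  assumes [measurable]: "f \<in> borel_measurable borel" "g \<in> borel_measurable borel" "h \<in> borel_measurable borel"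
    and le: "\<And>x y. f x * g y \<le> (h ((1/2) *\<^sub>R (x + y)))\<^sup>2"
  shows "(\<integral>\<^sup>+x. f x \<partial>lborel) * (\<integral>\<^sup>+x. g x \<partial>lborel) \<le> (\<integral>\<^sup>+x. h x \<partial>lborel)\<^sup>2"
proof -
  let ?e = "\<lambda>c :: 'a \<Rightarrow> real. \<Sum>b\<in>Basis. c b *\<^sub>R b"
  have eq: "(\<integral>\<^sup>+x. F x \<partial>lborel) = (\<integral>\<^sup>+c. F (?e c) \<partial>(\<Pi>\<^sub>M b\<in>Basis. lborel))"
    if [measurable]: "F \<in> borel_measurable borel" for F :: "'a \<Rightarrow> ennreal"
    by (subst lborel_eq) (simp add: nn_integral_distr)
  have "?e (midpoint_on Basis x y) = (1/2) *\<^sub>R (?e x + ?e y)" for x y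
    by (simp add: midpoint_on_def scaleR_sum_right scaleR_add_left scaleR_add_right add_divide_distrib
        flip: sum.distrib)
  then show ?thesis
    unfolding eq[OF assms(1)] eq[OF assms(2)] eq[OF assms(3)]
    by (intro Prekopa_Leindler_PiM) (auto simp: le)
qed

section \<open>Concentration of Gaussian support functions\<close>

text \<open>A common Lipschitz constant passes to the pointwise supremum. This supplies
  measurability of suprema over index sets that may be uncountable.\<close>

lemma continuous_on_SUP_lipschitz:
  fixes F :: "'b \<Rightarrow> 'a::metric_space \<Rightarrow> real"
  assumes ne: "T \<noteq> {}" and bdd: "\<And>z. bdd_above ((\<lambda>v. F v z) ` T)"
    and lip: "\<And>v z w. v \<in> T \<Longrightarrow> F v z \<le> F v w + L * dist z w" and L: "0 \<le> L"
  shows "continuous_on UNIV (\<lambda>z. SUP v\<in>T. F v z)"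
proof (rule lipschitz_on_continuous_on)
  have le: "(SUP v\<in>T. F v z) \<le> (SUP v\<in>T. F v w) + L * dist z w" for z w
  proof (rule cSUP_least[OF ne])
    fix v assume v: "v \<in> T"
    show "F v z \<le> (SUP v\<in>T. F v w) + L * dist z w"
      using lip[OF v, of z w] cSUP_upper[OF v bdd, of w] by simp
  qed
  show "L-lipschitz_on UNIV (\<lambda>z. SUP v\<in>T. F v z)"
  proof (rule lipschitz_onI[OF _ L])
    fix z w
    show "dist (SUP v\<in>T. F v z) (SUP v\<in>T. F v w) \<le> L * dist z w"
      using le[of z w] le[of w z] by (auto simp: dist_real_def dist_commute abs_le_iff)
  qed
qed

lemma isotropic_normal_density_eq:
  fixes z :: "real ^ 'n"
  assumes "\<sigma> > 0"
  shows "isotropic_normal_density \<sigma> z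
    = (1 / sqrt (2 * pi * \<sigma>\<^sup>2)) ^ CARD('n) * exp (- (norm z)\<^sup>2 / (2 * \<sigma>\<^sup>2))"
proof -
  have "(norm z)\<^sup>2 = (\<Sum>i\<in>UNIV. (z $ i)\<^sup>2)"
    unfolding power2_norm_eq_inner by (simp add: inner_vec_def power2_eq_square)
  then show ?thesis
    by (simp add: isotropic_normal_density_def normal_density_def prod.distrib prod_dividef
        sum_divide_distrib sum_negf power_divide flip: exp_sum)
qed

lemma borel_measurable_isotropic_normal_density [measurable]:
  "isotropic_normal_density \<sigma> \<in> borel_measurable (borel :: (real ^ 'n) measure)"
  unfolding isotropic_normal_density_def by measurable

text \<open>Completing the square identifies this with the difference of the squared norm of
  \<open>z\<close> and the squared distance from \<open>z\<close> to sigma^2 s T, divided by 2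
  sigma^2. The penalty is the logarithm of E exp (s z . v) under the Gaussian law.\<close>

definition shifted_support :: "real \<Rightarrow> (real ^ 'n) set \<Rightarrow> real \<Rightarrow> real ^ 'n \<Rightarrow> real"
  where "shifted_support \<sigma> T s z = (SUP v\<in>T. s * (z \<bullet> v) - s\<^sup>2 * \<sigma>\<^sup>2 * (norm v)\<^sup>2 / 2)"

definition support :: "(real ^ 'n) set \<Rightarrow> real ^ 'n \<Rightarrow> real"
  where "support T z = (SUP v\<in>T. z \<bullet> v)"

lemma exp_le_quadratic:
  fixes y :: real
  assumes "0 \<le> y"
  shows "exp y \<le> 1 + y + y\<^sup>2 * exp y"
proof -
  have "exp y * (1 + - y) \<le> exp y * exp (- y)"
    by (intro mult_left_mono exp_ge_add_one_self) auto
  then have *: "exp y - 1 \<le> y * exp y" by (simp add: algebra_simps flip: exp_add)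
  have "y * (exp y - 1) \<le> y * (y * exp y)"
    using * assms by (rule mult_left_mono)
  with * show ?thesis by (simp add: algebra_simps power2_eq_square)
qed

text \<open>As N = 2^k grows, E exp(X/N) is 1 + E X / N up to a term of order 1/N^2, so its N-th
  power is at most exp(E X + O(1/N)). Exponential integrability makes the remainder uniform in
  N.\<close>

lemma (in prob_space) le_exp_expectation_of_powers:
  fixes X :: "'a \<Rightarrow> real"
  assumes X [measurable]: "X \<in> borel_measurable M" and X0: "\<And>\<omega>. \<omega> \<in> space M \<Longrightarrow> 0 \<le> X \<omega>"
    and int: "integrable M (\<lambda>\<omega>. exp (2 * X \<omega>))"
    and le: "\<And>k::nat. A \<le> expectation (\<lambda>\<omega>. exp (X \<omega> / 2 ^ k)) ^ (2 ^ k)"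
  shows "A \<le> exp (expectation X)"
proof -
  have intX: "integrable M X"
  proof (rule Bochner_Integration.integrable_bound[OF int])
    show "AE \<omega> in M. norm (X \<omega>) \<le> norm (exp (2 * X \<omega>))"
    proof (rule AE_I2)
      fix \<omega> assume "\<omega> \<in> space M"
      then show "norm (X \<omega>) \<le> norm (exp (2 * X \<omega>))"
        using X0[of \<omega>] exp_ge_add_one_self[of "2 * X \<omega>"] by (simp del: exp_ge_add_one_self)
    qed
  qed simp
  \<comment> \<open>This constant bounds N^2 times the expected remainder: X^2 is at most 2 exp X by
    the quadratic Taylor bound, and exp(X/N) is at most exp X.\<close>
  define C where "C = expectation (\<lambda>\<omega>. 2 * exp (2 * X \<omega>))"
  have bound: "A \<le> exp (expectation X + C / 2 ^ k)" for k :: nat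
  proof -
    define N :: real where "N = 2 ^ k"
    have N: "N \<ge> 1" by (simp add: N_def)
    have pt: "exp (X \<omega> / N) \<le> 1 + X \<omega> / N + 2 * exp (2 * X \<omega>) / N\<^sup>2" if "\<omega> \<in> space M" for \<omega>
    proof -
      note x0 = X0[OF that]
      have "X \<omega> / N \<le> X \<omega>" using x0 N by (simp add: divide_le_eq mult_left_le mult_le_cancel_left1)
      have "(X \<omega>)\<^sup>2 * exp (X \<omega> / N) \<le> (2 * exp (X \<omega>)) * exp (X \<omega>)"
        using exp_lower_Taylor_quadratic[OF x0] x0 \<open>X \<omega> / N \<le> X \<omega>\<close> by (intro mult_mono) auto
      also have "\<dots> = 2 * exp (2 * X \<omega>)" by (simp flip: exp_add)
      finally have "(X \<omega> / N)\<^sup>2 * exp (X \<omega> / N) \<le> 2 * exp (2 * X \<omega>) / N\<^sup>2"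
        using N by (simp add: power_divide divide_right_mono)
      then show ?thesis using exp_le_quadratic[of "X \<omega> / N"] x0 N by simp
    qed
    have intR: "integrable M (\<lambda>\<omega>. 1 + X \<omega> / N + 2 * exp (2 * X \<omega>) / N\<^sup>2)"
      using intX int by auto
    have "expectation (\<lambda>\<omega>. exp (X \<omega> / N)) \<le> expectation (\<lambda>\<omega>. 1 + X \<omega> / N + 2 * exp (2 * X \<omega>) / N\<^sup>2)"
    proof (rule integral_mono)
      show "integrable M (\<lambda>\<omega>. exp (X \<omega> / N))"
      proof (rule Bochner_Integration.integrable_bound[OF intR])
        show "AE \<omega> in M. norm (exp (X \<omega> / N)) \<le> norm (1 + X \<omega> / N + 2 * exp (2 * X \<omega>) / N\<^sup>2)"
          using pt by (intro AE_I2) fastforce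
      qed simp
    qed (use intR pt in auto)
    also have "\<dots> = 1 + (expectation X + C / N) / N"
      using intX int by (simp add: C_def prob_space add_divide_distrib power2_eq_square)
    also have "\<dots> \<le> exp ((expectation X + C / N) / N)" by (rule exp_ge_add_one_self)
    finally have "expectation (\<lambda>\<omega>. exp (X \<omega> / N)) ^ (2 ^ k) \<le> exp ((expectation X + C / N) / N) ^ (2 ^ k)"
      by (intro power_mono integral_nonneg_AE) auto
    also have "\<dots> = exp (expectation X + C / N)"
      using N by (simp add: N_def flip: exp_of_nat_mult)
    finally show ?thesis using le[of k] by (simp add: N_def)
  qed
  have "(\<lambda>k. C / 2 ^ k) \<longlonglongrightarrow> 0"
    using tendsto_mult_right_zero[OF LIMSEQ_inverse_realpow_zero[of 2], of C] by (simp add: field_simps)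
  then have "(\<lambda>k. exp (expectation X + C / 2 ^ k)) \<longlonglongrightarrow> exp (expectation X + 0)"
    by (intro tendsto_intros)
  then show "A \<le> exp (expectation X)"
    using bound by (intro LIMSEQ_le_const) auto
qed

text \<open>Only the law \<open>N\<close> of the noise is kept, and \<open>T\<close> plays the role
  of the local set translated so that \<open>u\<close> becomes the origin. Having 0 in
  \<open>T\<close> makes the support function nonnegative. Total mass one is inherited from the
  noise being a random vector, so no Gaussian integral is computed.\<close>

locale gaussian_bounded_set =
  fixes \<sigma> R :: real and T :: "(real ^ 'n) set" and N :: "(real ^ 'n) measure"
  assumes sigma: "\<sigma> > 0" and zero_in: "0 \<in> T" and R: "\<And>v. v \<in> T \<Longrightarrow> norm v \<le> R"
    and N_eq: "N = density lborel (\<lambda>z. ennreal (isotropic_normal_density \<sigma> z))"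
    and prob: "prob_space N"
begin

sublocale prob_space N by (rule prob)

section \<open>Bounds, regularity and integrability of the support function\<close>

lemma sets_N [measurable_cong, simp]: "sets N = sets borel" by (simp add: N_eq)

lemma space_N [simp]: "space N = UNIV" by (simp add: N_eq)

lemma R_nonneg: "0 \<le> R" using R[OF zero_in] by simp

lemma inner_le: "v \<in> T \<Longrightarrow> z \<bullet> v \<le> R * norm z"
  using norm_cauchy_schwarz[of z v] R[of v] mult_left_mono[of "norm v" R "norm z"] by (simp add: mult.commute)

lemma bdd_support: "bdd_above ((\<lambda>v. z \<bullet> v) ` T)"
  using inner_le by (auto intro!: bdd_aboveI2)

lemma inner_le_support: "v \<in> T \<Longrightarrow> z \<bullet> v \<le> support T z"
  unfolding support_def by (rule cSUP_upper[OF _ bdd_support])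

lemma support_nonneg: "0 \<le> support T z"
  using inner_le_support[OF zero_in] by simp

lemma support_le: "support T z \<le> R * norm z"
  unfolding support_def using zero_in inner_le by (intro cSUP_least) auto

lemma bdd_shifted_support: "0 \<le> s \<Longrightarrow> bdd_above ((\<lambda>v. s * (z \<bullet> v) - s\<^sup>2 * \<sigma>\<^sup>2 * (norm v)\<^sup>2 / 2) ` T)"
proof (rule bdd_aboveI2)
  fix v assume "0 \<le> s" "v \<in> T"
  then have "s * (z \<bullet> v) \<le> s * (R * norm z)" by (intro mult_left_mono inner_le) auto
  moreover have "0 \<le> s\<^sup>2 * \<sigma>\<^sup>2 * (norm v)\<^sup>2 / 2" by simp
  ultimately show "s * (z \<bullet> v) - s\<^sup>2 * \<sigma>\<^sup>2 * (norm v)\<^sup>2 / 2 \<le> s * (R * norm z)" by linarith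
qed

lemma shifted_support_le: "0 \<le> s \<Longrightarrow> shifted_support \<sigma> T s z \<le> s * support T z"
  unfolding shifted_support_def
proof (rule cSUP_least)
  fix v assume "0 \<le> s" "v \<in> T"
  then have "s * (z \<bullet> v) \<le> s * support T z" by (intro mult_left_mono inner_le_support)
  moreover have "0 \<le> s\<^sup>2 * \<sigma>\<^sup>2 * (norm v)\<^sup>2 / 2" by simp
  ultimately show "s * (z \<bullet> v) - s\<^sup>2 * \<sigma>\<^sup>2 * (norm v)\<^sup>2 / 2 \<le> s * support T z" by linarith
qed (use zero_in in auto)

text \<open>On \<open>T\<close> the penalty never exceeds its value at norm \<open>R\<close>. This
  is the term that becomes the sub-Gaussian variance factor. The case s = 0 is separate because the
  argument divides by \<open>s\<close>.\<close>

lemma support_le_shifted_support: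
  assumes "0 \<le> s"
  shows "s * support T z \<le> shifted_support \<sigma> T s z + s\<^sup>2 * \<sigma>\<^sup>2 * R\<^sup>2 / 2"
proof (cases "s = 0")
  case True
  then show ?thesis using cSUP_upper[OF zero_in bdd_shifted_support[of s z]]
    by (simp add: shifted_support_def)
next
  case False
  have "support T z \<le> (shifted_support \<sigma> T s z + s\<^sup>2 * \<sigma>\<^sup>2 * R\<^sup>2 / 2) / s"
    unfolding support_def
  proof (rule cSUP_least)
    fix v assume v: "v \<in> T"
    have "s * (z \<bullet> v) - s\<^sup>2 * \<sigma>\<^sup>2 * (norm v)\<^sup>2 / 2 \<le> shifted_support \<sigma> T s z"
      unfolding shifted_support_def by (rule cSUP_upper[OF v bdd_shifted_support[OF assms]])
    moreover have "s\<^sup>2 * \<sigma>\<^sup>2 * (norm v)\<^sup>2 \<le> s\<^sup>2 * \<sigma>\<^sup>2 * R\<^sup>2"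
      using R[OF v] by (intro mult_left_mono power_mono) auto
    ultimately show "z \<bullet> v \<le> (shifted_support \<sigma> T s z + s\<^sup>2 * \<sigma>\<^sup>2 * R\<^sup>2 / 2) / s"
      using False assms by (simp add: field_simps)
  qed (use zero_in in auto)
  then show ?thesis using False assms by (simp add: field_simps)
qed

lemma continuous_on_support: "continuous_on UNIV (support T)"
  unfolding support_def
proof (rule continuous_on_SUP_lipschitz[where L=R])
  fix v z w :: "real ^ 'n" assume "v \<in> T"
  from inner_le[OF this, of "z - w"] show "z \<bullet> v \<le> w \<bullet> v + R * dist z w"
    by (simp add: inner_diff_left dist_norm)
qed (use zero_in bdd_support R_nonneg in auto)

lemma borel_measurable_support [measurable]: "support T \<in> borel_measurable borel"
  by (rule borel_measurable_continuous_onI[OF continuous_on_support])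

lemma borel_measurable_shifted_support:
  assumes s: "0 \<le> s"
  shows "shifted_support \<sigma> T s \<in> borel_measurable borel"
proof (rule borel_measurable_continuous_onI)
  show "continuous_on UNIV (shifted_support \<sigma> T s)"
    unfolding shifted_support_def
  proof (rule continuous_on_SUP_lipschitz[where L="s * R"])
    fix v z w :: "real ^ 'n" assume "v \<in> T"
    from mult_left_mono[OF inner_le[OF this, of "z - w"] s]
    show "s * (z \<bullet> v) - s\<^sup>2 * \<sigma>\<^sup>2 * (norm v)\<^sup>2 / 2
      \<le> s * (w \<bullet> v) - s\<^sup>2 * \<sigma>\<^sup>2 * (norm v)\<^sup>2 / 2 + s * R * dist z w"
      by (simp add: inner_diff_left dist_norm algebra_simps)
  qed (use zero_in bdd_shifted_support[OF s] R_nonneg s in auto)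
qed

text \<open>The exponential is absorbed by flattening the Gaussian: up to a constant factor, the
  weighted density at \<open>z\<close> is dominated by the density at z/2, whose integral is 2 to
  the dimension.\<close>

lemma integrable_exp_norm: "integrable N (\<lambda>z. exp (a * norm z))"
proof -
  let ?d = "isotropic_normal_density \<sigma> :: real ^ 'n \<Rightarrow> real"
  define c where "c = (1 / sqrt (2 * pi * \<sigma>\<^sup>2)) ^ CARD('n)"
  have total: "(\<integral>\<^sup>+z. ennreal (?d z) \<partial>lborel) = 1"
    using emeasure_space_1 by (simp add: N_eq emeasure_density)
  have "(\<integral>\<^sup>+z. ennreal (exp (a * norm z)) \<partial>N) = (\<integral>\<^sup>+z. ennreal (?d z * exp (a * norm z)) \<partial>lborel)"
    unfolding N_eq by (subst nn_integral_density) (auto simp: ennreal_mult'')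
  also have "\<dots> \<le> (\<integral>\<^sup>+z. ennreal (exp (a\<^sup>2 * \<sigma>\<^sup>2)) * ennreal (?d ((1/2) *\<^sub>R z)) \<partial>lborel)"
  proof (rule nn_integral_mono)
    fix z :: "real ^ 'n"
    \<comment> \<open>This square bounds a |z| by |z|^2/(4 sigma^2) plus a constant, and the
      exponents of the densities at \<open>z\<close> and z/2 differ by 3|z|^2/(8 sigma^2), which is
      enough to absorb it.\<close>
    have "0 \<le> (norm z / (2 * \<sigma>) - a * \<sigma>)\<^sup>2" by simp
    then have "a * norm z \<le> (norm z)\<^sup>2 / (4 * \<sigma>\<^sup>2) + a\<^sup>2 * \<sigma>\<^sup>2"
      using sigma by (simp add: power2_eq_square field_simps)
    then have "a * norm z \<le> (norm z)\<^sup>2 / \<sigma>\<^sup>2 / 4 + a\<^sup>2 * \<sigma>\<^sup>2" by simp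
    moreover have "- (norm z)\<^sup>2 / (2 * \<sigma>\<^sup>2) = - ((norm z)\<^sup>2 / \<sigma>\<^sup>2) / 2"
        "- (norm ((1/2) *\<^sub>R z))\<^sup>2 / (2 * \<sigma>\<^sup>2) = - ((norm z)\<^sup>2 / \<sigma>\<^sup>2) / 8"
      by (simp_all add: power_divide)
    moreover have "- q / 2 + r \<le> p + - q / 8" if "r \<le> q / 4 + p" "0 \<le> q" for p q r :: real
      using that by linarith
    note this[of "a * norm z" "(norm z)\<^sup>2 / \<sigma>\<^sup>2" "a\<^sup>2 * \<sigma>\<^sup>2"]
    ultimately have "- (norm z)\<^sup>2 / (2 * \<sigma>\<^sup>2) + a * norm z \<le> a\<^sup>2 * \<sigma>\<^sup>2 + - (norm ((1/2) *\<^sub>R z))\<^sup>2 / (2 * \<sigma>\<^sup>2)"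
      by (simp only:) simp
    then have "exp (- (norm z)\<^sup>2 / (2 * \<sigma>\<^sup>2)) * exp (a * norm z)
        \<le> exp (a\<^sup>2 * \<sigma>\<^sup>2) * exp (- (norm ((1/2) *\<^sub>R z))\<^sup>2 / (2 * \<sigma>\<^sup>2))"
      unfolding exp_add[symmetric] exp_le_cancel_iff .
    then have "c * (exp (- (norm z)\<^sup>2 / (2 * \<sigma>\<^sup>2)) * exp (a * norm z))
        \<le> c * (exp (a\<^sup>2 * \<sigma>\<^sup>2) * exp (- (norm ((1/2) *\<^sub>R z))\<^sup>2 / (2 * \<sigma>\<^sup>2)))"
      by (rule mult_left_mono) (simp add: c_def)
    then have "?d z * exp (a * norm z) \<le> exp (a\<^sup>2 * \<sigma>\<^sup>2) * ?d ((1/2) *\<^sub>R z)"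
      unfolding isotropic_normal_density_eq[OF sigma] c_def[symmetric]
      by (simp only: mult.assoc mult.left_commute[of c])
    then show "ennreal (?d z * exp (a * norm z)) \<le> ennreal (exp (a\<^sup>2 * \<sigma>\<^sup>2)) * ennreal (?d ((1/2) *\<^sub>R z))"
      by (simp add: ennreal_leI flip: ennreal_mult')
  qed
  also have "\<dots> = ennreal (exp (a\<^sup>2 * \<sigma>\<^sup>2)) * (\<integral>\<^sup>+z. ennreal (?d ((1/2) *\<^sub>R z)) \<partial>lborel)"
    by (rule nn_integral_cmult) simp
  also have "(\<integral>\<^sup>+z. ennreal (?d ((1/2) *\<^sub>R z)) \<partial>lborel) = ennreal (2 ^ CARD('n))"
    by (subst lborel_affine[of 2 0])
       (simp_all add: nn_integral_density nn_integral_distr nn_integral_cmult total)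
  finally have "(\<integral>\<^sup>+z. ennreal (exp (a * norm z)) \<partial>N) < \<infinity>"
    by (rule le_less_trans) (simp add: ennreal_mult_less_top)
  then show ?thesis by (intro integrableI_nonneg) auto
qed

lemma integrable_exp_support: "integrable N (\<lambda>z. exp (s * support T z))" if "0 \<le> s"
proof (rule Bochner_Integration.integrable_bound[OF integrable_exp_norm[of "s * R"]])
  show "AE z in N. norm (exp (s * support T z)) \<le> norm (exp (s * R * norm z))"
    using mult_left_mono[OF support_le that] by (simp add: mult.assoc)
qed simp

lemma integrable_exp_shifted_support:
  assumes s: "0 \<le> s"
  shows "integrable N (\<lambda>z. exp (shifted_support \<sigma> T s z))"
proof (rule Bochner_Integration.integrable_bound[OF integrable_exp_support[OF s]])
  note [measurable] = borel_measurable_shifted_support[OF s]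
  show "(\<lambda>z. exp (shifted_support \<sigma> T s z)) \<in> borel_measurable N" by measurable
qed (use shifted_support_le[OF s] in simp)

lemma expectation_exp_shifted_support_halve:
  assumes s: "0 \<le> s"
  shows "expectation (\<lambda>z. exp (shifted_support \<sigma> T s z))
    \<le> (expectation (\<lambda>z. exp (shifted_support \<sigma> T (s / 2) z)))\<^sup>2"
proof -
  have s2: "0 \<le> s / 2" using s by simp
  note [measurable] = borel_measurable_shifted_support[OF s] borel_measurable_shifted_support[OF s2]
  define c where "c = (1 / sqrt (2 * pi * \<sigma>\<^sup>2)) ^ CARD('n)"
  have c: "c > 0" using sigma by (simp add: c_def)
  let ?d = "isotropic_normal_density \<sigma> :: real ^ 'n \<Rightarrow> real"
  let ?f = "\<lambda>z. ennreal (?d z * exp (shifted_support \<sigma> T s z))"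
  let ?h = "\<lambda>z. ennreal (?d z * exp (shifted_support \<sigma> T (s/2) z))"
  have d: "?d z = c * exp (- (norm z)\<^sup>2 / (2 * \<sigma>\<^sup>2))" for z
    unfolding c_def by (rule isotropic_normal_density_eq[OF sigma])
  have eq: "(\<integral>\<^sup>+z. ennreal (?d z * exp (F z)) \<partial>lborel) = (\<integral>\<^sup>+z. ennreal (exp (F z)) \<partial>N)"
    if [measurable]: "F \<in> borel_measurable borel" for F
    unfolding N_eq by (subst nn_integral_density) (auto simp: ennreal_mult'')
  \<comment> \<open>The second function is the bare density, that is the parameter 0, whose integral
    is 1; halving \<open>s\<close> corresponds to averaging \<open>s\<close> with 0.\<close>
  have "(\<integral>\<^sup>+z. ?f z \<partial>lborel) * (\<integral>\<^sup>+z. ennreal (?d z) \<partial>lborel) \<le> (\<integral>\<^sup>+z. ?h z \<partial>lborel)\<^sup>2"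
  proof (rule Prekopa_Leindler)
    fix x y :: "real ^ 'n"
    define m where "m = (1/2) *\<^sub>R (x + y)"
    have rearr: "q \<le> p + 2 * l'" if "0 \<le> p + 2 * l - q" "l \<le> l'" for p q l l' :: real
      using that by linarith
    have "shifted_support \<sigma> T s x \<le> (norm x)\<^sup>2 / (2 * \<sigma>\<^sup>2) + (norm y)\<^sup>2 / (2 * \<sigma>\<^sup>2)
        - (norm m)\<^sup>2 / \<sigma>\<^sup>2 + 2 * shifted_support \<sigma> T (s/2) m"
      unfolding shifted_support_def[of \<sigma> T s x]
    proof (rule cSUP_least)
      fix v assume v: "v \<in> T"
      have up: "(s/2) * (m \<bullet> v) - (s/2)\<^sup>2 * \<sigma>\<^sup>2 * (norm v)\<^sup>2 / 2 \<le> shifted_support \<sigma> T (s/2) m"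
        unfolding shifted_support_def by (rule cSUP_upper[OF v bdd_shifted_support[OF s2]])
      \<comment> \<open>Parallelogram identity for the points x - s sigma^2 v and y, whose midpoint
        is m - (s/2) sigma^2 v. The same \<open>v\<close> then serves as competitor in the supremum
        at \<open>m\<close>.\<close>
      have "0 \<le> (norm (x - (s * \<sigma>\<^sup>2) *\<^sub>R v - y))\<^sup>2 / (4 * \<sigma>\<^sup>2)" by simp
      also have "\<dots> = (norm x)\<^sup>2 / (2 * \<sigma>\<^sup>2) + (norm y)\<^sup>2 / (2 * \<sigma>\<^sup>2) - (norm m)\<^sup>2 / \<sigma>\<^sup>2
        + 2 * ((s/2) * (m \<bullet> v) - (s/2)\<^sup>2 * \<sigma>\<^sup>2 * (norm v)\<^sup>2 / 2)
        - (s * (x \<bullet> v) - s\<^sup>2 * \<sigma>\<^sup>2 * (norm v)\<^sup>2 / 2)"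
       
      proof -
        have "(norm (x - (s * \<sigma>\<^sup>2) *\<^sub>R v - y))\<^sup>2
          = x \<bullet> x + (s * \<sigma>\<^sup>2)\<^sup>2 * (v \<bullet> v) + y \<bullet> y
            - 2 * (s * \<sigma>\<^sup>2) * (x \<bullet> v) - 2 * (x \<bullet> y) + 2 * (s * \<sigma>\<^sup>2) * (y \<bullet> v)"
          unfolding power2_norm_eq_inner
          by (simp add: inner_diff_left inner_diff_right inner_commute power2_eq_square)
        note eqs = this
        have "(norm m)\<^sup>2 = (x \<bullet> x + 2 * (x \<bullet> y) + y \<bullet> y) / 4"
          unfolding power2_norm_eq_inner m_def
          by (simp add: inner_add_left inner_add_right inner_commute)
        note eqs = eqs this
        have "m \<bullet> v = (x \<bullet> v + y \<bullet> v) / 2"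
          by (simp add: m_def inner_add_left)
        note eqs = eqs this
        show ?thesis
          using sigma unfolding eqs power2_norm_eq_inner[of x] power2_norm_eq_inner[of y] power2_norm_eq_inner[of v]
          by (simp add: power2_eq_square field_simps)
      qed
      finally show "s * (x \<bullet> v) - s\<^sup>2 * \<sigma>\<^sup>2 * (norm v)\<^sup>2 / 2 \<le> (norm x)\<^sup>2 / (2 * \<sigma>\<^sup>2) + (norm y)\<^sup>2 / (2 * \<sigma>\<^sup>2)
        - (norm m)\<^sup>2 / \<sigma>\<^sup>2 + 2 * shifted_support \<sigma> T (s/2) m"
        using up by (rule rearr)
    qed (use zero_in in auto)
    moreover have "2 * (- (norm m)\<^sup>2 / (2 * \<sigma>\<^sup>2) + shifted_support \<sigma> T (s/2) m)
        = - ((norm m)\<^sup>2 / \<sigma>\<^sup>2) + 2 * shifted_support \<sigma> T (s/2) m" by simp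
    ultimately have "exp (- (norm x)\<^sup>2 / (2 * \<sigma>\<^sup>2) + shifted_support \<sigma> T s x + - (norm y)\<^sup>2 / (2 * \<sigma>\<^sup>2))
      \<le> exp (2 * (- (norm m)\<^sup>2 / (2 * \<sigma>\<^sup>2) + shifted_support \<sigma> T (s/2) m))"
      by simp
    then have "c\<^sup>2 * exp (- (norm x)\<^sup>2 / (2 * \<sigma>\<^sup>2) + shifted_support \<sigma> T s x + - (norm y)\<^sup>2 / (2 * \<sigma>\<^sup>2))
      \<le> c\<^sup>2 * exp (2 * (- (norm m)\<^sup>2 / (2 * \<sigma>\<^sup>2) + shifted_support \<sigma> T (s/2) m))"
      by (rule mult_left_mono) simp
    also have "\<dots> = (?d m * exp (shifted_support \<sigma> T (s/2) m))\<^sup>2"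
      by (simp only: d exp_double exp_add power_mult_distrib mult.assoc)
    also have "c\<^sup>2 * exp (- (norm x)\<^sup>2 / (2 * \<sigma>\<^sup>2) + shifted_support \<sigma> T s x + - (norm y)\<^sup>2 / (2 * \<sigma>\<^sup>2))
      = ?d x * exp (shifted_support \<sigma> T s x) * ?d y"
      by (simp only: d exp_add power2_eq_square[of c] ac_simps)
    finally show "?f x * ennreal (?d y) \<le> (?h ((1/2) *\<^sub>R (x + y)))\<^sup>2"
      using c by (simp add: m_def d ennreal_power ennreal_leI flip: ennreal_mult)
  qed auto
  moreover have "(\<integral>\<^sup>+z. ennreal (?d z) \<partial>lborel) = 1"
    using emeasure_space_1 by (simp add: N_eq emeasure_density)
  ultimately have "(\<integral>\<^sup>+z. ennreal (exp (shifted_support \<sigma> T s z)) \<partial>N)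
      \<le> (\<integral>\<^sup>+z. ennreal (exp (shifted_support \<sigma> T (s/2) z)) \<partial>N)\<^sup>2"
    by (simp add: eq)
  then show ?thesis
    by (simp add: nn_integral_eq_integral[OF integrable_exp_shifted_support[OF s]]
        nn_integral_eq_integral[OF integrable_exp_shifted_support[OF s2]] ennreal_power)
qed

section \<open>Moment generating function and tail of the support function\<close>

lemma expectation_exp_shifted_support_dyadic:
  assumes s: "0 \<le> s"
  shows "expectation (\<lambda>z. exp (shifted_support \<sigma> T s z))
    \<le> expectation (\<lambda>z. exp (shifted_support \<sigma> T (s / 2 ^ k) z)) ^ (2 ^ k)"
proof (induction k)
  case (Suc k)
  note Suc
  also have "expectation (\<lambda>z. exp (shifted_support \<sigma> T (s / 2 ^ k) z)) ^ (2 ^ k)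
      \<le> ((expectation (\<lambda>z. exp (shifted_support \<sigma> T (s / 2 ^ k / 2) z)))\<^sup>2) ^ (2 ^ k)"
    using s by (intro power_mono expectation_exp_shifted_support_halve) auto
  finally show ?case by (simp add: mult.commute flip: power_mult)
qed simp

text \<open>After \<open>k\<close> halvings the penalty is simply dropped. It is quadratic in s/2^k,
  so even after raising to the power 2^k its effect vanishes in the limit, and no constant is
  lost.\<close>

theorem expectation_exp_shifted_support_le:
  assumes s: "0 \<le> s"
  shows "expectation (\<lambda>z. exp (shifted_support \<sigma> T s z)) \<le> exp (s * expectation (support T))"
proof -
  have "expectation (\<lambda>z. exp (shifted_support \<sigma> T s z)) \<le> exp (expectation (\<lambda>z. s * support T z))"
  proof (rule le_exp_expectation_of_powers)
    show "integrable N (\<lambda>z. exp (2 * (s * support T z)))"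
      using integrable_exp_support[of "2 * s"] s by (simp add: mult.assoc)
    fix k :: nat
    have sk: "0 \<le> s / 2 ^ k" using s by simp
    have "expectation (\<lambda>z. exp (shifted_support \<sigma> T s z))
      \<le> expectation (\<lambda>z. exp (shifted_support \<sigma> T (s / 2 ^ k) z)) ^ (2 ^ k)"
      by (rule expectation_exp_shifted_support_dyadic[OF s])
    also have "\<dots> \<le> expectation (\<lambda>z. exp (s / 2 ^ k * support T z)) ^ (2 ^ k)"
      using shifted_support_le[OF sk]
      by (intro power_mono integral_mono integrable_exp_shifted_support[OF sk] integrable_exp_support[OF sk]) auto
    finally show "expectation (\<lambda>z. exp (shifted_support \<sigma> T s z))
      \<le> expectation (\<lambda>z. exp (s * support T z / 2 ^ k)) ^ (2 ^ k)" by simp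
  qed (use s support_nonneg in auto)
  then show ?thesis by simp
qed

theorem mgf_support_le:
  assumes s: "0 \<le> s"
  shows "expectation (\<lambda>z. exp (s * support T z)) \<le> exp (s * expectation (support T) + s\<^sup>2 * \<sigma>\<^sup>2 * R\<^sup>2 / 2)"
proof -
  have "expectation (\<lambda>z. exp (s * support T z))
    \<le> expectation (\<lambda>z. exp (s\<^sup>2 * \<sigma>\<^sup>2 * R\<^sup>2 / 2) * exp (shifted_support \<sigma> T s z))"
    using support_le_shifted_support[OF s] integrable_exp_shifted_support[OF s] integrable_exp_support[OF s]
    by (intro integral_mono integrable_mult_right) (auto simp: add.commute simp flip: exp_add)
  also have "\<dots> \<le> exp (s\<^sup>2 * \<sigma>\<^sup>2 * R\<^sup>2 / 2) * exp (s * expectation (support T))"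
    using expectation_exp_shifted_support_le[OF s] by simp
  finally show ?thesis by (simp add: add.commute flip: exp_add)
qed

theorem support_concentration:
  assumes r: "0 \<le> r" and R: "0 < R"
  shows "prob {z. expectation (support T) + r \<le> support T z} \<le> exp (- r\<^sup>2 / (2 * \<sigma>\<^sup>2 * R\<^sup>2))"
proof -
  \<comment> \<open>The minimiser of s^2 sigma^2 R^2 / 2 - s r, the exponent in the Chernoff
    bound.\<close>
  define s where "s = r / (\<sigma>\<^sup>2 * R\<^sup>2)"
  define E where "E = expectation (support T)"
  have s: "0 \<le> s" using r by (simp add: s_def)
  have "prob {z. E + r \<le> support T z} = expectation (indicator {z. E + r \<le> support T z})"
    by simp
  also have "\<dots> \<le> expectation (\<lambda>z. exp (- s * (E + r)) * exp (s * support T z))"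
  proof (rule integral_mono)
    fix z
    show "indicator {z. E + r \<le> support T z} z \<le> exp (- s * (E + r)) * exp (s * support T z)"
      using mult_left_mono[OF _ s, of "E + r" "support T z"]
      by (auto simp: indicator_def simp flip: exp_add)
  qed (use integrable_exp_support[OF s] in \<open>auto simp: less_top[symmetric]\<close>)
  also have "\<dots> \<le> exp (- s * (E + r)) * exp (s * E + s\<^sup>2 * \<sigma>\<^sup>2 * R\<^sup>2 / 2)"
    using mgf_support_le[OF s] by (simp add: E_def)
  also have "\<dots> = exp (- r\<^sup>2 / (2 * \<sigma>\<^sup>2 * R\<^sup>2))"
    using sigma R by (simp add: s_def power2_eq_square field_simps flip: exp_add)
  finally show ?thesis by (simp add: E_def)
qed

end

section \<open>Least squares over a closed convex set\<close>

lemma scaled_norm_power2: "(scaled_norm v)\<^sup>2 = (norm v)\<^sup>2 / real CARD('n)" for v :: "real ^ 'n"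
proof -
  have "(norm v)\<^sup>2 = (\<Sum>i\<in>UNIV. (v $ i)\<^sup>2)"
    unfolding power2_norm_eq_inner by (simp add: inner_vec_def power2_eq_square)
  then show ?thesis by (simp add: scaled_norm_def sum_nonneg)
qed

text \<open>Uniqueness of the projection onto a closed convex set turns an arbitrary selection of
  minimisers into a fixed continuous function of \<open>y\<close>; measurability of the event will
  follow from this.\<close>

lemma least_squares_estimator_eq_closest_point:
  fixes K :: "(real ^ 'n) set"
  assumes "closed K" "convex K" "least_squares_estimator K y m"
  shows "m = closest_point K y"
proof (rule closest_point_unique)
  have "m \<in> K" and "\<And>v. v \<in> K \<Longrightarrow> (scaled_norm (y - m))\<^sup>2 \<le> (scaled_norm (y - v))\<^sup>2"
    using assms(3) by (auto simp: least_squares_estimator_def is_arg_min_def not_less)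
  then show "m \<in> K" "\<forall>v\<in>K. dist y m \<le> dist y v"
    by (auto simp: scaled_norm_power2 dist_norm divide_le_cancel)
qed (use assms in auto)

text \<open>The obtuse-angle property of the projection is used instead of mere minimality, which
  would give the bound without the negative quadratic term.\<close>

lemma closest_point_excess_le:
  fixes K :: "'a::euclidean_space set" and \<mu> z :: 'a
  assumes "closed K" "convex K" "u \<in> K"
  defines "p \<equiv> closest_point K (\<mu> + z)"
  shows "(norm (p - \<mu>))\<^sup>2 - (norm (u - \<mu>))\<^sup>2 \<le> 2 * (z \<bullet> (p - u)) - (norm (p - u))\<^sup>2"
proof -
  have "(\<mu> + z - p) \<bullet> (u - p) \<le> 0"
    unfolding p_def by (rule closest_point_dot[OF assms(2,1,3)])
  then show ?thesis
    unfolding power2_norm_eq_inner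
    by (simp add: inner_diff_left inner_diff_right inner_add_left inner_add_right inner_commute)
qed

text \<open>Within distance \<open>t\<close> of \<open>u\<close> the bound on \<open>Z\<close>
  applies directly, and a slack of a^2/2 is affordable. Farther away, convexity allows
  \<open>p\<close> to be pulled back to distance \<open>t\<close>; then z . (p - u) grows at most
  linearly with slope Z/t, and the quadratic term wins as long as Z/t is at most t + a, which
  affords a slack of t^2/2. Hence the minimum of the two.\<close>

lemma linear_minus_quadratic_le:
  fixes K :: "'a::real_inner set" and z u p :: 'a
  assumes "convex K" "u \<in> K" "p \<in> K" and t: "t > 0" and a: "a \<ge> 0"
    and Z: "\<And>v. v \<in> K \<Longrightarrow> norm (v - u) \<le> t \<Longrightarrow> z \<bullet> (v - u) \<le> Z"
    and Z_le: "Z \<le> t\<^sup>2 / 2 + (t * a + min (t\<^sup>2 / 2) (a\<^sup>2 / 2))"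
  shows "2 * (z \<bullet> (p - u)) - (norm (p - u))\<^sup>2 \<le> (t + a)\<^sup>2"
proof (cases "norm (p - u) \<le> t")
  case True
  have "2 * (z \<bullet> (p - u)) \<le> t\<^sup>2 + 2 * (t * a) + a\<^sup>2"
    using Z[OF \<open>p \<in> K\<close> True] Z_le by (simp add: min_def split: if_splits)
  also have "\<dots> = (t + a)\<^sup>2" by (simp add: power2_sum)
  finally show ?thesis using zero_le_power2[of "norm (p - u)"] by linarith
next
  case False
  define s where "s = norm (p - u)"
  have s: "s > t" "s > 0" using False t by (auto simp: s_def)
  \<comment> \<open>The point of the segment from \<open>u\<close> to \<open>p\<close> at distance
    exactly \<open>t\<close> from \<open>u\<close>.\<close>
  define v where "v = (1 - t / s) *\<^sub>R u + (t / s) *\<^sub>R p"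
  have vu: "v - u = (t / s) *\<^sub>R (p - u)" by (simp add: v_def algebra_simps)
  have "v \<in> K" unfolding v_def
    using s t by (intro convexD_alt[OF assms(1-3)]) auto
  moreover have "norm (v - u) \<le> t" using s t by (simp add: vu s_def[symmetric])
  ultimately have "(t / s) * (z \<bullet> (p - u)) \<le> Z" using Z[of v] by (simp add: vu)
  then have zZ: "z \<bullet> (p - u) \<le> s * (Z / t)" using s t by (simp add: field_simps)
  have "0 \<le> Z" using Z[OF \<open>u \<in> K\<close>] t by simp
  moreover have "Z \<le> t * (t + a)" using Z_le
    by (simp add: min_def power2_eq_square distrib_left split: if_splits)
  ultimately have "0 \<le> Z / t" "Z / t \<le> t + a" using t by (auto simp: field_simps)
  then have "(Z / t)\<^sup>2 \<le> (t + a)\<^sup>2" by (intro power_mono)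
  moreover have "2 * (s * (Z / t)) - s\<^sup>2 \<le> (Z / t)\<^sup>2"
    using zero_le_power2[of "Z / t - s"] by (simp only: power2_diff) (simp add: mult.commute mult.left_commute)
  ultimately show ?thesis using zZ unfolding s_def by linarith
qed

theorem theorem2p3:
  fixes M :: "'a measure"
    and K :: "(real ^ 'n) set"
    and \<mu> u :: "real ^ 'n"
    and \<sigma> t x :: real
    and \<xi> y \<mu>_LS :: "'a \<Rightarrow> real ^ 'n"
  assumes "prob_space M"
    and "closed K" and "convex K"
    and "\<sigma> > 0"
    and "distributed M lborel \<xi> (\<lambda>z. ennreal (isotropic_normal_density \<sigma> z))"
    and "\<And>\<omega>. \<omega> \<in> space M \<Longrightarrow> y \<omega> = \<mu> + \<xi> \<omega>"
    and "\<And>\<omega>. \<omega> \<in> space M \<Longrightarrow> least_squares_estimator K (y \<omega>) (\<mu>_LS \<omega>)"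
    and "u \<in> K" and "t > 0"
    and "prob_space.expectation M
           (\<lambda>\<omega>. SUP v\<in>{v \<in> K. norm (v - u) \<le> t}. \<xi> \<omega> \<bullet> (v - u)) \<le> t\<^sup>2 / 2"
    and "x > 0"
  shows "measure M {\<omega> \<in> space M.
             (scaled_norm (\<mu>_LS \<omega> - \<mu>))\<^sup>2 - (scaled_norm (u - \<mu>))\<^sup>2
               \<le> (t + \<sigma> * sqrt (2 * x))\<^sup>2 / real CARD('n) \<and>
             (t + \<sigma> * sqrt (2 * x))\<^sup>2 / real CARD('n)
               \<le> (2 * t\<^sup>2 + 4 * \<sigma>\<^sup>2 * x) / real CARD('n)}
         > 1 - exp (- x)"
proof -
  interpret M: prob_space M by fact
  define T where "T = (\<lambda>v. v - u) ` {v \<in> K. norm (v - u) \<le> t}"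
  define N where "N = distr M lborel \<xi>"
  have xi [measurable]: "\<xi> \<in> borel_measurable M"
    using distributed_measurable[OF assms(5)] by simp
  interpret G: gaussian_bounded_set \<sigma> t T N
  proof (rule gaussian_bounded_set.intro)
    show "0 \<in> T" using \<open>u \<in> K\<close> \<open>t > 0\<close> by (auto simp: T_def image_iff)
    show "N = density lborel (\<lambda>z. ennreal (isotropic_normal_density \<sigma> z))"
      unfolding N_def by (rule distributed_distr_eq_density[OF assms(5)])
    show "prob_space N" unfolding N_def by (rule M.prob_space_distr) simp
  qed (use \<open>\<sigma> > 0\<close> in \<open>auto simp: T_def\<close>)
  define a where "a = \<sigma> * sqrt (2 * x)"
  \<comment> \<open>The minimum is the slack that makes the final probability bound strict.\<close>
  define r where "r = t * a + min (t\<^sup>2 / 2) (a\<^sup>2 / 2)"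
  have a: "a > 0" "a\<^sup>2 = 2 * \<sigma>\<^sup>2 * x"
    using \<open>\<sigma> > 0\<close> \<open>x > 0\<close> by (simp_all add: a_def power_mult_distrib)
  have ta_r: "t * a < r" using a(1) \<open>t > 0\<close> by (simp add: r_def)
  have r0: "0 \<le> r" using ta_r a(1) \<open>t > 0\<close> by (smt (verit) mult_nonneg_nonneg)
  have expectation_le: "G.expectation (support T) \<le> t\<^sup>2 / 2"
  proof -
    have "G.expectation (support T) = M.expectation (\<lambda>\<omega>. support T (\<xi> \<omega>))"
      unfolding N_def by (rule integral_distr) simp_all
    then show ?thesis using assms(10) by (simp add: support_def T_def image_image)
  qed
  have LS: "\<mu>_LS \<omega> = closest_point K (\<mu> + \<xi> \<omega>)" if "\<omega> \<in> space M" for \<omega>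
    using least_squares_estimator_eq_closest_point[OF assms(2,3) assms(7)[OF that]] assms(6)[OF that] by simp
  \<comment> \<open>The second inequality of the conclusion is deterministic, from 2 t a being at
    most t^2 + a^2, so it does not shrink the event.\<close>
  have two: "(t + a)\<^sup>2 \<le> 2 * t\<^sup>2 + 4 * \<sigma>\<^sup>2 * x"
    using zero_le_power2[of "t - a"] a(2) by (simp add: power2_sum power2_diff algebra_simps)
  let ?good = "{\<omega> \<in> space M. (scaled_norm (\<mu>_LS \<omega> - \<mu>))\<^sup>2 - (scaled_norm (u - \<mu>))\<^sup>2
        \<le> (t + a)\<^sup>2 / real CARD('n) \<and>
      (t + a)\<^sup>2 / real CARD('n) \<le> (2 * t\<^sup>2 + 4 * \<sigma>\<^sup>2 * x) / real CARD('n)}"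
  let ?D = "{z. (norm (closest_point K (\<mu> + z) - \<mu>))\<^sup>2 - (norm (u - \<mu>))\<^sup>2 \<le> (t + a)\<^sup>2}"
  \<comment> \<open>The event depends on the sample point only through the noise, so its probability
    can be computed under the law \<open>N\<close>.\<close>
  have good: "?good = \<xi> -` ?D \<inter> space M"
    using two by (auto simp: LS scaled_norm_power2 divide_le_cancel simp flip: diff_divide_distrib)
  have D: "?D \<in> sets borel"
  proof -
    have [measurable]: "closest_point K \<in> borel_measurable borel"
      using \<open>u \<in> K\<close> by (intro borel_measurable_continuous_onI continuous_on_closest_point assms) auto
    show ?thesis by measurable
  qed
  have "1 - G.prob ?D = G.prob (- ?D)"
    using G.prob_compl[of ?D] D by (simp add: Compl_eq_Diff_UNIV)
  also have "\<dots> \<le> G.prob {z. G.expectation (support T) + r \<le> support T z}"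
  proof (rule G.finite_measure_mono)
    \<comment> \<open>Contrapositive: if the local supremum stays below its mean plus
      \<open>r\<close>, the localisation bound holds and the excess risk is small.\<close>
    show "- ?D \<subseteq> {z. G.expectation (support T) + r \<le> support T z}"
    proof (rule subsetI, rule ccontr)
      fix z assume "z \<in> - ?D" and "z \<notin> {z. G.expectation (support T) + r \<le> support T z}"
      then have "support T z \<le> t\<^sup>2 / 2 + r" using expectation_le by simp
      moreover have "closest_point K (\<mu> + z) \<in> K"
        using \<open>u \<in> K\<close> \<open>closed K\<close> by (intro closest_point_in_set) auto
      ultimately have "2 * (z \<bullet> (closest_point K (\<mu> + z) - u)) - (norm (closest_point K (\<mu> + z) - u))\<^sup>2 \<le> (t + a)\<^sup>2"
        using a(1) G.inner_le_support unfolding r_def T_def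
        by (intro linear_minus_quadratic_le[OF \<open>convex K\<close> \<open>u \<in> K\<close> _ \<open>t > 0\<close>]) auto
      with closest_point_excess_le[OF assms(2,3) \<open>u \<in> K\<close>, of \<mu> z] \<open>z \<in> - ?D\<close> show False by auto
    qed
  qed measurable
  also have "\<dots> \<le> exp (- r\<^sup>2 / (2 * \<sigma>\<^sup>2 * t\<^sup>2))"
    by (rule G.support_concentration[OF r0 \<open>t > 0\<close>])
  also have "\<dots> < exp (- x)"
  proof -
    \<comment> \<open>At r = t a the exponent would be exactly -x, since a^2 = 2 sigma^2 x; the
      excess of \<open>r\<close> over t a makes the bound strict.\<close>
    have "(t * a)\<^sup>2 < r\<^sup>2" using ta_r a(1) \<open>t > 0\<close> by (intro power_strict_mono) auto
    then have "x * (2 * \<sigma>\<^sup>2 * t\<^sup>2) < r\<^sup>2" using a(2) by (simp add: power_mult_distrib mult_ac)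
    then show ?thesis using \<open>\<sigma> > 0\<close> \<open>t > 0\<close> by (simp add: pos_less_divide_eq)
  qed
  also have "G.prob ?D = M.prob ?good"
    unfolding good N_def using D by (subst measure_distr) auto
  finally show ?thesis unfolding a_def by simp
qed

end
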